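(* Let $r\in\mathbb{N}$, let $a_1,a_{r+1}\in\mathbb{N}$ and $a_j\in\mathbb{N}_0$ for $2\le j\le r$, and put $\mathbf{s}=(\{2\}^{a_1},1,\{2\}^{a_2},1,\dots,\{2\}^{a_r},1,\{2\}^{a_{r+1}})$. Then \[ \zeta^\star(\mathbf{s})=-\sum_{\mathbf{p}\in\Pi(2a_1+1,\,2a_2+1,\,\dots,\,2a_r+1,\,\overline{2a_{r+1}})} 2^{\ell(\mathbf{p})}\zeta(\mathbf{p}). \]
   Context: $\mathbb{N}=\{1,2,\dots\}$, $\mathbb{N}_0=\mathbb{N}\cup\{0\}$. For a positive integer $m$, $\overline{m}$ denotes $-m$. For $\mathbf{s}=(s_1,\dots,s_\ell)$ with all $s_i$ nonzero integers, define $H_n(\mathbf{s})=\sum_{n\ge k_1>\cdots>k_\ell\ge1}\prod_{i=1}^\ell \frac{\operatorname{sgn}(s_i)^{k_i}}{k_i^{|s_i|}}$ and $H^\star_n(\mathbf{s})=\sum_{n\ge k_1\ge\cdots\ge k_\ell\ge1}\prod_{i=1}^\ell \frac{\operatorname{sgn}(s_i)^{k_i}}{k_i^{|s_i|}}$; when $s_1\ne1$ set $\zeta(\mathbf{s})=\lim_{n\to\infty}H_n(\mathbf{s})$ and $\zeta^\star(\mathbf{s})=\lim_{n\to\infty}H^\star_n(\mathbf{s})$ (alternating Euler sums). $\{2\}^a$ denotes $a$ consecutive copies of $2$ (empty if $a=0$). For nonzero integers $a,b$ define $a\oplus b=\operatorname{sgn}(a)\,b+\operatorname{sgn}(b)\,a$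 (this operation is associative, with $|a\oplus b|=|a|+|b|$ and $\operatorname{sgn}(a\oplus b)=\operatorname{sgn}(a)\operatorname{sgn}(b)$). For a sequence $(s_1,\dots,s_m)$ of nonzero integers, $\Pi(s_1,\dots,s_m)$ is the set of the $2^{m-1}$ indices $s_1\circ s_2\circ\cdots\circ s_m$ where each $\circ$ is independently either the comma "," or $\oplus$ (entries joined by $\oplus$ are combined into a single component). $\ell(\mathbf{p})$ is the number of components of $\mathbf{p}$. *)

theory Defs
  imports "HOL-Analysis.Analysis"
begin

text \<open>
  An index is a list of nonzero integers; the barred entry \<open>m\<close> of the usual notation for
  alternating Euler sums is the integer \<open>-m\<close>. Summation variables
  \<open>k\<^sub>1, \<dots>, k\<^sub>\<ell>\<close> are collected in a list.
\<close>

definition euler_term :: "int list \<Rightarrow> nat list \<Rightarrow> real" where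
  "euler_term s ks =
     (\<Prod>i<length s. real_of_int (sgn (s ! i)) ^ (ks ! i) / real (ks ! i) ^ nat \<bar>s ! i\<bar>)"

definition H :: "nat \<Rightarrow> int list \<Rightarrow> real" where
  "H n s = (\<Sum>ks | length ks = length s \<and> set ks \<subseteq> {1..n} \<and> sorted_wrt (>) ks. euler_term s ks)"

definition H_star :: "nat \<Rightarrow> int list \<Rightarrow> real" where
  "H_star n s = (\<Sum>ks | length ks = length s \<and> set ks \<subseteq> {1..n} \<and> sorted_wrt (\<ge>) ks. euler_term s ks)"

text \<open>As \<^const>\<open>lim\<close> is total, the two values below are meaningful only for indices
  whose first entry is not \<open>1\<close>.\<close>

definition zeta :: "int list \<Rightarrow> real" where
  "zeta s = lim (\<lambda>n. H n s)"

definition zeta_star :: "int list \<Rightarrow> real" where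
  "zeta_star s = lim (\<lambda>n. H_star n s)"

definition oplus :: "int \<Rightarrow> int \<Rightarrow> int" where
  "oplus a b = sgn a * b + sgn b * a"

text \<open>\<open>merges [s\<^sub>1, \<dots>, s\<^sub>m]\<close> is the set \<open>\<Pi>(s\<^sub>1, \<dots>, s\<^sub>m)\<close>: the two members of the union
  correspond to the leftmost separator being a comma or \<^const>\<open>oplus\<close>.\<close>

fun merges :: "int list \<Rightarrow> int list set" where
  "merges [] = {[]}"
| "merges [a] = {[a]}"
| "merges (a # b # s) = (#) a ` merges (b # s) \<union> merges (oplus a b # s)"

lemma abs_oplus: "a \<noteq> 0 \<Longrightarrow> b \<noteq> 0 \<Longrightarrow> \<bar>oplus a b\<bar> = \<bar>a\<bar> + \<bar>b\<bar>"
  by (auto simp: oplus_def sgn_if)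

lemma finite_merges: "finite (merges s)"
  by (induction s rule: merges.induct) auto

lemma merges_hd:
  "q \<in> merges s \<Longrightarrow> s \<noteq> [] \<Longrightarrow> 0 \<notin> set s \<Longrightarrow> \<bar>hd s\<bar> \<le> \<bar>hd q\<bar>"
proof (induction s arbitrary: q rule: merges.induct)
  case (3 a b s)
  have nz: "\<bar>oplus a b\<bar> = \<bar>a\<bar> + \<bar>b\<bar>" using 3 by (intro abs_oplus) auto
  moreover have "oplus a b \<noteq> 0" using nz 3 by auto
  ultimately show ?case using 3 by fastforce
qed auto

text \<open>Distinct choices of separators give distinct indices, so that a sum over the set
  \<^term>\<open>merges s\<close> counts every choice exactly once.\<close>

lemma card_merges: "s \<noteq> [] \<Longrightarrow> 0 \<notin> set s \<Longrightarrow> card (merges s) = 2 ^ (length s - 1)"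
proof (induction s rule: merges.induct)
  case (3 a b s)
  have ab: "\<bar>oplus a b\<bar> = \<bar>a\<bar> + \<bar>b\<bar>" using 3 by (intro abs_oplus) auto
  have nz: "0 \<notin> set (oplus a b # s)" using ab 3 by auto
  have "(#) a ` merges (b # s) \<inter> merges (oplus a b # s) = {}"
    using merges_hd[OF _ _ nz] ab 3 by fastforce
  then have "card (merges (a # b # s)) = card ((#) a ` merges (b # s)) + card (merges (oplus a b # s))"
    by (simp add: card_Un_disjoint finite_merges)
  also have "\<dots> = 2 ^ length s + 2 ^ length s"
    using 3 nz by (simp add: card_image)
  finally show ?case by simp
qed auto

end

theory Submission
  imports Defs "HOL-Real_Asymp.Real_Asymp"
begin

text \<open>
  The identity already holds for the finite sums, once the leading summation variable is weighted
  by \<open>c\<^sub>n(k) = (n choose k) / ((n + k) choose k)\<close>. Put \<open>T g n = (\<Sum>k=1..n. c\<^sub>n(k) * g k)\<close>.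
  From \<open>c\<^sub>n(k) - c\<^sub>n\<^sub>-\<^sub>1(k) = c\<^sub>n(k) k\<^sup>2 / n\<^sup>2\<close> one sees that, if \<open>H_star n s = T g n\<close>, prepending \<open>2\<close> to
  \<open>s\<close> replaces \<open>g k\<close> by \<open>g k / k\<^sup>2\<close>. A telescoping sum shows that prepending \<open>1\<close> replaces it by
  \<open>(g k + 2 * (\<Sum>j<k. g j)) / k\<close>, whose two summands are the choices \<open>\<oplus>\<close> and comma in \<open>\<Pi>\<close>.
  The recursion starts from \<open>1 = T (\<lambda>k. - 2 * (-1) ^ k) n\<close>. Finally \<open>c\<^sub>n(k)\<close> tends to \<open>1\<close> with
  \<open>0 \<le> c\<^sub>n(k) \<le> 1\<close>, and since \<open>a 1 \<ge> 1\<close> every leading exponent is at least \<open>3\<close>, so all series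
  converge absolutely and Tannery's theorem applies.
\<close>

section \<open>Nested sums: splitting off the largest summation variable\<close>

lemma decreasing_lists_Suc:
  fixes R :: "nat \<Rightarrow> nat \<Rightarrow> bool"
  assumes "\<And>k j. k \<in> {1..n} \<Longrightarrow> j \<in> {1..n} \<and> R k j \<longleftrightarrow> j \<in> {1..f k}"
  shows "{ks. length ks = Suc m \<and> set ks \<subseteq> {1..n} \<and> sorted_wrt R ks} =
    (\<lambda>(k, ks). k # ks) ` (SIGMA k:{1..n}. {ks. length ks = m \<and> set ks \<subseteq> {1..f k} \<and> sorted_wrt R ks})"
    (is "?L = ?R")
proof (rule set_eqI)
  fix ks
  show "ks \<in> ?L \<longleftrightarrow> ks \<in> ?R"
  proof (cases ks)
    case (Cons k js)
    have "set js \<subseteq> {1..n} \<and> (\<forall>j\<in>set js. R k j) \<longleftrightarrow> set js \<subseteq> {1..f k}" if "k \<in> {1..n}"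
      using assms[OF that] by blast
    then show ?thesis using Cons by (auto simp: image_iff)
  qed auto
qed

lemma euler_term_Cons:
  "euler_term (x # s) (k # ks) = real_of_int (sgn x) ^ k / real k ^ nat \<bar>x\<bar> * euler_term s ks"
  unfolding euler_term_def by (simp add: prod.lessThan_Suc_shift del: prod.lessThan_Suc)

lemma finite_sorted_lists:
  "finite {ks. length ks = m \<and> set ks \<subseteq> {1..n::nat} \<and> sorted_wrt R ks}"
  by (rule finite_subset[OF _ finite_lists_length_eq[of "{1..n}" m]]) auto

text \<open>The bound \<open>f\<close> stands for both orders: \<open>f k = k - 1\<close> for the
  strict sums \<open>H\<close>, \<open>f k = k\<close> for the weak sums \<open>H_star\<close>. One
  argument thus yields both recursions.\<close>

lemma sum_euler_term_Cons:
  fixes R :: "nat \<Rightarrow> nat \<Rightarrow> bool"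
  assumes "\<And>k j. k \<in> {1..n} \<Longrightarrow> j \<in> {1..n} \<and> R k j \<longleftrightarrow> j \<in> {1..f k}"
  shows "(\<Sum>ks | length ks = length (x # s) \<and> set ks \<subseteq> {1..n} \<and> sorted_wrt R ks. euler_term (x # s) ks)
    = (\<Sum>k=1..n. real_of_int (sgn x) ^ k / real k ^ nat \<bar>x\<bar> *
        (\<Sum>ks | length ks = length s \<and> set ks \<subseteq> {1..f k} \<and> sorted_wrt R ks. euler_term s ks))"
proof -
  have inj: "inj_on (\<lambda>(k, ks). k # ks) A" for A :: "(nat \<times> nat list) set"
    by (auto simp: inj_on_def)
  let ?L = "\<lambda>k. {ks. length ks = length s \<and> set ks \<subseteq> {1..f k} \<and> sorted_wrt R ks}"
  let ?w = "\<lambda>k. real_of_int (sgn x) ^ k / real k ^ nat \<bar>x\<bar>"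
  have "{ks. length ks = length (x # s) \<and> set ks \<subseteq> {1..n} \<and> sorted_wrt R ks}
      = (\<lambda>(k, ks). k # ks) ` (SIGMA k:{1..n}. ?L k)"
    using decreasing_lists_Suc[where n = n and f = f and R = R and m = "length s"] assms by simp
  then have "(\<Sum>ks | length ks = length (x # s) \<and> set ks \<subseteq> {1..n} \<and> sorted_wrt R ks. euler_term (x # s) ks)
      = (\<Sum>(k, ks)\<in>(SIGMA k:{1..n}. ?L k). ?w k * euler_term s ks)"
    by (simp only: sum.reindex[OF inj]) (auto simp: euler_term_Cons intro!: sum.cong)
  also have "\<dots> = (\<Sum>k=1..n. \<Sum>ks\<in>?L k. ?w k * euler_term s ks)"
    by (rule sum.Sigma[symmetric]) (simp_all only: finite_atLeastAtMost finite_sorted_lists simp_thms Ball_def)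
  finally show ?thesis
    by (simp only: sum_distrib_left)
qed

lemma H_Nil [simp]: "H n [] = 1" and H_star_Nil [simp]: "H_star n [] = 1"
proof -
  have "{ks. length ks = length [] \<and> set ks \<subseteq> {1..n} \<and> sorted_wrt R ks} = {[]}" for R
    by auto
  then show "H n [] = 1" "H_star n [] = 1"
    unfolding H_def H_star_def by (simp_all add: euler_term_def)
qed

lemma H_Cons:
  "H n (x # s) = (\<Sum>k=1..n. real_of_int (sgn x) ^ k / real k ^ nat \<bar>x\<bar> * H (k - 1) s)"
  unfolding H_def by (rule sum_euler_term_Cons) auto

lemma H_star_Cons:
  "H_star n (x # s) = (\<Sum>k=1..n. real_of_int (sgn x) ^ k / real k ^ nat \<bar>x\<bar> * H_star k s)"
  unfolding H_star_def by (rule sum_euler_term_Cons) auto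

lemma abs_sgn_power_le: "\<bar>real_of_int (sgn x) ^ k\<bar> \<le> 1"
  by (simp add: power_abs sgn_if power_le_one)

text \<open>A crude bound suffices: the inner sum up to \<open>k - 1\<close> is at most
  \<open>k\<close>, which one power of \<open>k\<close> in the denominator absorbs, so each of the
  \<open>n\<close> outer terms is at most \<open>1\<close>.\<close>

lemma abs_H_le:
  assumes "0 \<notin> set s"
  shows "\<bar>H n s\<bar> \<le> real n + 1"
  using assms
proof (induction s arbitrary: n)
  case (Cons x s)
  have "\<bar>real_of_int (sgn x) ^ k / real k ^ nat \<bar>x\<bar> * H (k - 1) s\<bar> \<le> 1" if "k \<in> {1..n}" for k
  proof -
    have "\<bar>H (k - 1) s\<bar> \<le> real k ^ 1"
      using Cons.IH[of "k - 1"] Cons.prems that by auto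
    also have "\<dots> \<le> real k ^ nat \<bar>x\<bar>"
      using that Cons.prems by (intro power_increasing) auto
    finally have "\<bar>real_of_int (sgn x) ^ k\<bar> * \<bar>H (k - 1) s\<bar> \<le> 1 * real k ^ nat \<bar>x\<bar>"
      using abs_sgn_power_le[of x k] by (intro mult_mono) auto
    then show ?thesis
      using that by (simp add: abs_mult divide_le_eq)
  qed
  then have "\<bar>H n (x # s)\<bar> \<le> (\<Sum>k=1..n. 1)"
    unfolding H_Cons by (intro order_trans[OF sum_abs sum_mono]) auto
  then show ?case by simp
qed simp

section \<open>The binomial weights\<close>

text \<open>This is \<open>(n choose k) / ((n + k) choose k)\<close>; in particular it vanishes for \<open>k > n\<close>.\<close>

definition binom_ratio :: "nat \<Rightarrow> nat \<Rightarrow> real" where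
  "binom_ratio n k = (\<Prod>j<k. (real n - real j) / (real n + real j + 1))"

lemma binom_ratio_0 [simp]: "binom_ratio n 0 = 1"
  by (simp add: binom_ratio_def)

lemma binom_ratio_eq_0: "n < k \<Longrightarrow> binom_ratio n k = 0"
  by (auto simp: binom_ratio_def)

lemma binom_ratio_Suc_right:
  "(real n + real k + 1) * binom_ratio n (Suc k) = (real n - real k) * binom_ratio n k"
  by (simp add: binom_ratio_def field_simps)

text \<open>Free of division, so that it covers \<open>k = n + 1\<close>, where both sides
  vanish.\<close>

lemma binom_ratio_Suc_left:
  "binom_ratio (Suc n) k * ((real n + 1)\<^sup>2 - (real k)\<^sup>2) = (real n + 1)\<^sup>2 * binom_ratio n k"
proof (induction k)
  case (Suc k)
  have "binom_ratio (Suc n) (Suc k) * ((real n + 1)\<^sup>2 - (real (Suc k))\<^sup>2)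
      = ((real (Suc n) + real k + 1) * binom_ratio (Suc n) (Suc k)) * (real n - real k)"
    by (simp add: power2_eq_square algebra_simps)
  \<comment> \<open>From here the chain carries an extra factor \<open>n + k + 1\<close>. It
    completes \<open>(n + 1)^2 - k^2\<close> for the induction hypothesis, reappears through the
    recurrence for \<open>n\<close>, and is cancelled at the end because it is positive.\<close>
  also have "\<dots> * (real n + real k + 1)
      = (binom_ratio (Suc n) k * ((real n + 1)\<^sup>2 - (real k)\<^sup>2)) * (real n - real k)"
    unfolding binom_ratio_Suc_right by (simp add: power2_eq_square algebra_simps)
  also have "\<dots> = (real n + 1)\<^sup>2 * ((real n - real k) * binom_ratio n k)"
    unfolding Suc.IH by simp
  also have "\<dots> = (real n + 1)\<^sup>2 * binom_ratio n (Suc k) * (real n + real k + 1)"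
    unfolding binom_ratio_Suc_right[symmetric] by simp
  finally show ?case by simp
qed simp

lemma binom_ratio_nonneg: "0 \<le> binom_ratio n k"
proof (cases "k \<le> n")
  case True
  then show ?thesis unfolding binom_ratio_def by (intro prod_nonneg) auto
qed (simp add: binom_ratio_eq_0)

lemma binom_ratio_le_1: "binom_ratio n k \<le> 1"
proof (cases "k \<le> n")
  case True
  then show ?thesis unfolding binom_ratio_def by (intro prod_le_1) (auto simp: divide_le_eq)
qed (simp add: binom_ratio_eq_0)

lemma binom_ratio_tendsto_1: "(\<lambda>n. binom_ratio n k) \<longlonglongrightarrow> 1"
proof -
  have "(\<lambda>n. (real n - real j) / (real n + real j + 1)) \<longlonglongrightarrow> 1" for j
    by real_asymp
  then have "(\<lambda>n. binom_ratio n k) \<longlonglongrightarrow> (\<Prod>j<k. 1)"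
    unfolding binom_ratio_def by (intro tendsto_prod) auto
  then show ?thesis by simp
qed

section \<open>Summation rules for the weighted sums\<close>

definition binom_transform :: "(nat \<Rightarrow> real) \<Rightarrow> nat \<Rightarrow> real" where
  "binom_transform g n = (\<Sum>k=1..n. binom_ratio n k * g k)"

lemma binom_transform_cong:
  "(\<And>k. k \<ge> 1 \<Longrightarrow> g k = h k) \<Longrightarrow> binom_transform g n = binom_transform h n"
  by (simp add: binom_transform_def)

lemma binom_transform_0 [simp]: "binom_transform g 0 = 0"
  by (simp add: binom_transform_def)

lemma binom_transform_diff:
  "binom_transform g (Suc n) - binom_transform g n
    = binom_transform (\<lambda>k. (real k)\<^sup>2 * g k) (Suc n) / (real (Suc n))\<^sup>2"
proof -
  \<comment> \<open>The added term \<open>k = Suc n\<close> has weight \<open>0\<close>; now both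
    transforms run over the same range.\<close>
  have "binom_transform g n = (\<Sum>k=1..Suc n. binom_ratio n k * g k)"
    by (simp add: binom_transform_def binom_ratio_eq_0)
  moreover have "binom_ratio (Suc n) k - binom_ratio n k
      = binom_ratio (Suc n) k * (real k)\<^sup>2 / (real (Suc n))\<^sup>2" for k
    using binom_ratio_Suc_left[of n k] by (simp add: field_simps add.commute)
  then have "binom_ratio (Suc n) k * g k - binom_ratio n k * g k
      = binom_ratio (Suc n) k * ((real k)\<^sup>2 * g k) / (real (Suc n))\<^sup>2" for k
    by (metis (no_types, lifting) left_diff_distrib mult.assoc times_divide_eq_left)
  ultimately show ?thesis
    unfolding binom_transform_def sum_divide_distrib
    by (simp add: sum_subtractf[symmetric] del: sum.cl_ivl_Suc of_nat_Suc)
qed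

text \<open>Telescopes \<open>binom_transform_diff\<close>. It evaluates the outermost sum of
  \<open>H_star\<close> once its summand is known as a transform.\<close>

lemma sum_binom_transform:
  assumes "\<And>m. m \<ge> 1 \<Longrightarrow> m \<le> n \<Longrightarrow> f m = binom_transform (\<lambda>k. (real k)\<^sup>2 * g k) m / (real m)\<^sup>2"
  shows "(\<Sum>m=1..n. f m) = binom_transform g n"
  using assms
proof (induction n)
  case (Suc n)
  then show ?case using binom_transform_diff[of g n] by simp
qed simp

lemma binom_transform_power_minus_1:
  assumes "n \<ge> 1"
  shows "binom_transform (\<lambda>k. (-1) ^ k) n = - 1 / 2"
proof -
  \<comment> \<open>A telescoping primitive: the recurrence in \<open>k\<close> turns
    \<open>e (Suc k)\<close> into \<open>-(-1)^k (n - k)\<close> times the weight at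
    \<open>k\<close>, and \<open>(n + k) + (n - k) = 2 n\<close>.\<close>
  define e where "e k = (-1) ^ k * (real n + real k) * binom_ratio n k" for k
  have e: "binom_ratio n k * (-1) ^ k * (2 * real n) = e k - e (Suc k)" for k
  proof -
    have "e k - e (Suc k)
        = (-1) ^ k * ((real n + real k) * binom_ratio n k + (real n + real k + 1) * binom_ratio n (Suc k))"
      by (simp add: e_def algebra_simps)
    then show ?thesis
      unfolding binom_ratio_Suc_right by (simp add: algebra_simps)
  qed
  have "binom_transform (\<lambda>k. (-1) ^ k) n * (2 * real n) = (\<Sum>k=1..n. e k - e (Suc k))"
    unfolding binom_transform_def sum_distrib_right e ..
  also have "\<dots> = e 1 - e (Suc n)"
    using sum_Suc_diff[of 1 "Suc n" "\<lambda>k. - e k"] by simp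
  also have "e (Suc n) = 0" by (simp add: e_def binom_ratio_eq_0)
  also have "e 1 = - real n"
    using binom_ratio_Suc_right[of n 0] by (simp add: e_def algebra_simps)
  finally have "real n * (2 * binom_transform (\<lambda>k. (-1) ^ k) n) = real n * (- 1)" by (simp add: mult_ac)
  then have "2 * binom_transform (\<lambda>k. (-1) ^ k) n = - 1" using assms by (subst (asm) mult_left_cancel) auto
  then show ?thesis by simp
qed

text \<open>Summation by parts. With \<open>e\<close> as below, \<open>e k - e (Suc k)\<close> is
  \<open>2 k\<close> times the weight at \<open>k\<close>, so the double sum contributes
  \<open>n - k\<close> times weight and \<open>g k\<close>; the single sum contributes the missing
  \<open>k\<close>.\<close>

lemma binom_transform_partial_sums:
  "binom_transform (\<lambda>k. real k * (g k + 2 * (\<Sum>j=1..k - 1. g j))) n = real n * binom_transform g n"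
proof -
  define e where "e k = (real n + real k) * binom_ratio n k" for k
  have e_Suc: "e (Suc k) = (real n - real k) * binom_ratio n k" for k
    using binom_ratio_Suc_right[of n k] by (simp add: e_def algebra_simps)
  \<comment> \<open>Induction needs a general upper limit \<open>m\<close> and hence a boundary
    term; at \<open>m = n\<close> it disappears, since \<open>e (Suc n) = 0\<close>.\<close>
  have partial: "(\<Sum>k=1..m. real k * binom_ratio n k * (g k + 2 * (\<Sum>j=1..k - 1. g j)))
      = real n * (\<Sum>k=1..m. binom_ratio n k * g k) - e (Suc m) * (\<Sum>j=1..m. g j)" for m
  proof (induction m)
    case (Suc m)
    let ?A = "\<Sum>k=1..m. binom_ratio n k * g k" and ?S = "\<Sum>j=1..m. g j"
    have "(\<Sum>k=1..Suc m. real k * binom_ratio n k * (g k + 2 * (\<Sum>j=1..k - 1. g j)))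
        = (real n * ?A - e (Suc m) * ?S)
          + real (Suc m) * binom_ratio n (Suc m) * (g (Suc m) + 2 * ?S)"
      using Suc.IH by simp
    also have "\<dots> = real n * (?A + binom_ratio n (Suc m) * g (Suc m))
        - e (Suc (Suc m)) * (?S + g (Suc m))"
      unfolding e_Suc[of "Suc m"] by (simp add: e_def algebra_simps)
    finally show ?case by simp
  qed simp
  show ?thesis
    using partial[of n] e_Suc[of n] by (simp add: binom_transform_def mult_ac)
qed

section \<open>Prepending the entries 2 and 1\<close>

lemma H_star_2_Cons:
  assumes "\<And>n. n \<ge> 1 \<Longrightarrow> H_star n s = binom_transform g n"
  shows "H_star n (2 # s) = binom_transform (\<lambda>k. g k / (real k)\<^sup>2) n"
  unfolding H_star_Cons
  by (rule sum_binom_transform) (auto simp: assms intro!: binom_transform_cong)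

lemma H_star_replicate_2:
  assumes "\<And>n. n \<ge> 1 \<Longrightarrow> H_star n s = binom_transform g n" and "n \<ge> 1"
  shows "H_star n (replicate b 2 @ s) = binom_transform (\<lambda>k. g k / real k ^ (2 * b)) n"
  using \<open>n \<ge> 1\<close>
proof (induction b arbitrary: n)
  case (Suc b)
  have "H_star n (2 # (replicate b 2 @ s)) = binom_transform (\<lambda>k. g k / real k ^ (2 * b) / (real k)\<^sup>2) n"
    by (rule H_star_2_Cons) (rule Suc.IH)
  then show ?case by (simp add: power2_eq_square mult_ac)
qed (simp add: assms)

lemma H_star_1_Cons:
  assumes "\<And>n. n \<ge> 1 \<Longrightarrow> H_star n s = binom_transform g n"
  shows "H_star n (1 # s) = binom_transform (\<lambda>k. (g k + 2 * (\<Sum>j=1..k - 1. g j)) / real k) n"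
  unfolding H_star_Cons
proof (rule sum_binom_transform)
  fix m :: nat
  assume "m \<ge> 1"
  \<comment> \<open>The factor \<open>m\<close> gained here, divided by \<open>m^2\<close>, is the
    \<open>1 / m\<close> of the new entry \<open>1\<close>.\<close>
  have "binom_transform (\<lambda>k. (real k)\<^sup>2 * ((g k + 2 * (\<Sum>j=1..k - 1. g j)) / real k)) m
      = binom_transform (\<lambda>k. real k * (g k + 2 * (\<Sum>j=1..k - 1. g j))) m"
    by (rule binom_transform_cong) (simp add: power2_eq_square)
  also have "\<dots> = real m * binom_transform g m"
    by (rule binom_transform_partial_sums)
  finally show "real_of_int (sgn 1) ^ m / real m ^ nat \<bar>1\<bar> * H_star m s
      = binom_transform (\<lambda>k. (real k)\<^sup>2 * ((g k + 2 * (\<Sum>j=1..k - 1. g j)) / real k)) m / (real m)\<^sup>2"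
    using \<open>m \<ge> 1\<close> assms[of m] by (simp add: power2_eq_square)
qed

section \<open>Weighted sums over merged indices\<close>

definition leading_term :: "int list \<Rightarrow> nat \<Rightarrow> real" where
  "leading_term p k = real_of_int (sgn (hd p)) ^ k / real k ^ nat \<bar>hd p\<bar> * H (k - 1) (tl p)"

lemma H_eq_sum_leading_term: "p \<noteq> [] \<Longrightarrow> H n p = (\<Sum>k=1..n. leading_term p k)"
  by (cases p) (simp_all add: leading_term_def H_Cons)

text \<open>Summed over \<open>k\<close> this is the sum over merged indices in the theorem. The
  leading variable is kept free because only it carries a binomial weight.\<close>

definition merge_sum :: "int list \<Rightarrow> nat \<Rightarrow> real" where
  "merge_sum s k = (\<Sum>p\<in>merges s. 2 ^ length p * leading_term p k)"

lemma oplus_nonzero: "a \<noteq> 0 \<Longrightarrow> b \<noteq> 0 \<Longrightarrow> oplus a b \<noteq> 0"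
  using abs_oplus[of a b] by auto

lemma sgn_oplus: "a \<noteq> 0 \<Longrightarrow> b \<noteq> 0 \<Longrightarrow> sgn (oplus a b) = sgn a * sgn b"
  by (auto simp: oplus_def sgn_if)

lemma oplus_assoc: "a \<noteq> 0 \<Longrightarrow> b \<noteq> 0 \<Longrightarrow> c \<noteq> 0 \<Longrightarrow> oplus (oplus a b) c = oplus a (oplus b c)"
  by (auto simp: oplus_def sgn_if)

lemma merges_nonempty: "p \<in> merges s \<Longrightarrow> s \<noteq> [] \<Longrightarrow> p \<noteq> []"
  by (induction s arbitrary: p rule: merges.induct) auto

lemma zero_notin_merges: "p \<in> merges s \<Longrightarrow> 0 \<notin> set s \<Longrightarrow> 0 \<notin> set p"
  by (induction s arbitrary: p rule: merges.induct) (auto simp: oplus_nonzero)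

lemma merge_sum_Cons_Cons:
  assumes "a \<noteq> 0" "b \<noteq> 0" "0 \<notin> set s"
  shows "merge_sum (a # b # s) k
    = 2 * (real_of_int (sgn a) ^ k / real k ^ nat \<bar>a\<bar>) * (\<Sum>j=1..k - 1. merge_sum (b # s) j)
      + merge_sum (oplus a b # s) k"
proof -
  \<comment> \<open>The first entries differ: in the second set their absolute value is at least
    that of \<open>oplus a b\<close>, which exceeds that of \<open>a\<close>.\<close>
  have "(#) a ` merges (b # s) \<inter> merges (oplus a b # s) = {}"
    using merges_hd[of _ "oplus a b # s"] abs_oplus[of a b] oplus_nonzero[of a b] assms by fastforce
  then have "merge_sum (a # b # s) k
      = (\<Sum>p\<in>(#) a ` merges (b # s). 2 ^ length p * leading_term p k) + merge_sum (oplus a b # s) k"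
    by (simp add: merge_sum_def sum.union_disjoint finite_merges)
  also have "(\<Sum>p\<in>(#) a ` merges (b # s). 2 ^ length p * leading_term p k)
      = 2 * (real_of_int (sgn a) ^ k / real k ^ nat \<bar>a\<bar>) * (\<Sum>p\<in>merges (b # s). 2 ^ length p * H (k - 1) p)"
    by (simp add: sum.reindex leading_term_def sum_distrib_left mult_ac)
  also have "(\<Sum>p\<in>merges (b # s). 2 ^ length p * H (k - 1) p) = (\<Sum>j=1..k - 1. merge_sum (b # s) j)"
    unfolding merge_sum_def sum.swap[of _ _ "{1..k - 1}"]
    by (intro sum.cong refl) (simp add: H_eq_sum_leading_term merges_nonempty sum_distrib_left)
  finally show ?thesis .
qed

text \<open>Under \<open>oplus\<close> signs multiply and absolute values add, so absorbing
  \<open>a\<close> multiplies every leading term by the factor of \<open>a\<close>. The induction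
  varies \<open>b\<close>, since associativity moves the next merge to
  \<open>oplus b c\<close>.\<close>

lemma merge_sum_oplus:
  assumes "a \<noteq> 0" "b \<noteq> 0" "0 \<notin> set s"
  shows "merge_sum (oplus a b # s) k
    = real_of_int (sgn a) ^ k / real k ^ nat \<bar>a\<bar> * merge_sum (b # s) k"
  using assms
proof (induction s arbitrary: b)
  case Nil
  then show ?case
    by (simp add: merge_sum_def leading_term_def sgn_oplus abs_oplus nat_add_distrib power_add
        power_mult_distrib)
next
  case (Cons c s)
  then have IH: "merge_sum (oplus a (oplus b c) # s) k
      = real_of_int (sgn a) ^ k / real k ^ nat \<bar>a\<bar> * merge_sum (oplus b c # s) k"
    by (intro Cons.IH) (auto simp: oplus_nonzero)
  show ?case
    using Cons.prems IH
    by (simp add: merge_sum_Cons_Cons oplus_nonzero oplus_assoc sgn_oplus abs_oplus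
        nat_add_distrib power_add power_mult_distrib algebra_simps)
qed

text \<open>The bracket is the operation that \<open>H_star_1_Cons\<close> performs on
  \<open>g\<close>; this match drives the induction for the finite identity.\<close>

lemma merge_sum_Cons:
  assumes "a \<noteq> 0" "s \<noteq> []" "0 \<notin> set s"
  shows "merge_sum (a # s) k = real_of_int (sgn a) ^ k / real k ^ nat \<bar>a\<bar> *
    (merge_sum s k + 2 * (\<Sum>j=1..k - 1. merge_sum s j))"
  using assms
  by (cases s) (simp_all add: merge_sum_Cons_Cons merge_sum_oplus algebra_simps)

section \<open>The identity for finite sums\<close>

lemma H_star_eq_binom_transform:
  assumes "c \<ge> 1" "n \<ge> 1"
  shows "H_star n (concat (map (\<lambda>b. replicate b 2 @ [1]) bs) @ replicate c 2)
    = binom_transform (\<lambda>k. - merge_sum (map (\<lambda>b. 2 * int b + 1) bs @ [- (2 * int c)]) k) n"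
  using \<open>n \<ge> 1\<close>
proof (induction bs arbitrary: n)
  case Nil
  \<comment> \<open>The \<open>2\<close> will be \<open>2 ^ length p\<close> for a single entry, and
    \<open>(-1) ^ k\<close> the sign of the barred entry. The restriction \<open>m \<ge> 1\<close>
    matters: at \<open>0\<close> the transform is \<open>0\<close> but
    \<open>H_star 0 [] = 1\<close>.\<close>
  have "H_star m [] = binom_transform (\<lambda>k. - 2 * (-1) ^ k) m" if "m \<ge> 1" for m
  proof -
    have "binom_transform (\<lambda>k. - 2 * (-1) ^ k) m = - 2 * binom_transform (\<lambda>k. (-1) ^ k) m"
      by (simp add: binom_transform_def sum_distrib_left mult_ac)
    then show ?thesis using that by (simp add: binom_transform_power_minus_1)
  qed
  from H_star_replicate_2[OF this Nil, of c] show ?case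
    using \<open>c \<ge> 1\<close> by (simp add: merge_sum_def leading_term_def nat_mult_distrib)
next
  case (Cons b bs)
  define s where "s = concat (map (\<lambda>b. replicate b 2 @ [1::int]) bs) @ replicate c 2"
  define t where "t = map (\<lambda>b. 2 * int b + 1) bs @ [- (2 * int c)]"
  have t: "t \<noteq> []" "0 \<notin> set t"
    using \<open>c \<ge> 1\<close> by (auto simp: t_def)
  have "H_star m (1 # s)
      = binom_transform (\<lambda>k. (- merge_sum t k + 2 * (\<Sum>j=1..k - 1. - merge_sum t j)) / real k) m" for m
    by (rule H_star_1_Cons) (unfold s_def t_def, rule Cons.IH)
  from H_star_replicate_2[OF this Cons.prems, of b]
  have "H_star n (replicate b 2 @ 1 # s) = binom_transform
      (\<lambda>k. (- merge_sum t k + 2 * (\<Sum>j=1..k - 1. - merge_sum t j)) / real k / real k ^ (2 * b)) n" .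
  also have "\<dots> = binom_transform (\<lambda>k. - merge_sum ((2 * int b + 1) # t) k) n"
  proof (rule binom_transform_cong)
    fix k :: nat
    have "nat (2 * int b + 1) = Suc (2 * b)" by simp
    then show "(- merge_sum t k + 2 * (\<Sum>j=1..k - 1. - merge_sum t j)) / real k / real k ^ (2 * b)
        = - merge_sum ((2 * int b + 1) # t) k"
      using t by (subst merge_sum_Cons) (auto simp: sum_negf add_divide_distrib diff_divide_distrib mult_ac)
  qed
  finally show ?case by (simp add: s_def t_def)
qed

section \<open>Absolute convergence and passage to the limit\<close>

lemma abs_leading_term_le:
  assumes "0 \<notin> set p" "p \<noteq> []" "\<bar>hd p\<bar> \<ge> 3"
  shows "\<bar>leading_term p k\<bar> \<le> 1 / (real k)\<^sup>2"
proof (cases "k = 0")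
  case False
  have "0 \<notin> set (tl p)" using assms(1,2) by (cases p) auto
  then have "\<bar>H (k - 1) (tl p)\<bar> \<le> real k"
    using abs_H_le[of "tl p" "k - 1"] False by simp
  then have "\<bar>real_of_int (sgn (hd p)) ^ k\<bar> * \<bar>H (k - 1) (tl p)\<bar> \<le> 1 * real k"
    using abs_sgn_power_le by (intro mult_mono) auto
  moreover have "real k ^ 3 \<le> real k ^ nat \<bar>hd p\<bar>"
    using False assms(3) by (intro power_increasing) auto
  \<comment> \<open>The linear bound on \<open>H\<close> costs one power of \<open>k\<close>;
    exponent \<open>3\<close> still leaves \<open>1 / k^2\<close>.\<close>
  ultimately have "\<bar>leading_term p k\<bar> \<le> real k / real k ^ 3"
    unfolding leading_term_def abs_mult abs_divide times_divide_eq_left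
    using False by (intro frac_le) auto
  then show ?thesis using False by (simp add: power2_eq_square power3_eq_cube)
next
  case True
  \<comment> \<open>At \<open>k = 0\<close> both sides are \<open>0\<close>, by the convention for
    division by zero.\<close>
  have "nat \<bar>hd p\<bar> \<noteq> 0" using assms(3) by simp
  then show ?thesis using True by (simp add: leading_term_def power_0_left)
qed

lemma summable_leading_term:
  assumes "0 \<notin> set p" "p \<noteq> []" "\<bar>hd p\<bar> \<ge> 3"
  shows "summable (leading_term p)"
proof (rule summable_comparison_test')
  show "summable (\<lambda>k. inverse (real k ^ 2))"
    by (rule inverse_power_summable) simp
  show "norm (leading_term p k) \<le> inverse (real k ^ 2)" if "0 \<le> k" for k
    using abs_leading_term_le[OF assms, of k] by (simp add: inverse_eq_divide)
qed

lemma leading_term_0: "hd p \<noteq> 0 \<Longrightarrow> leading_term p 0 = 0"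
  by (simp add: leading_term_def)

lemma sum_atLeast1_eq_lessThan:
  fixes f :: "nat \<Rightarrow> 'a::comm_monoid_add"
  shows "f 0 = 0 \<Longrightarrow> (\<Sum>k=1..n. f k) = (\<Sum>k<Suc n. f k)"
  by (simp add: sum.atLeast1_atMost_eq sum.lessThan_Suc_shift del: sum.lessThan_Suc)

lemma zeta_eq_suminf:
  assumes "0 \<notin> set p" "p \<noteq> []" "\<bar>hd p\<bar> \<ge> 3"
  shows "zeta p = (\<Sum>k. leading_term p k)"
proof -
  have "leading_term p 0 = 0" using assms by (intro leading_term_0) auto
  then have "H n p = (\<Sum>k<Suc n. leading_term p k)" for n
    unfolding H_eq_sum_leading_term[OF assms(2)] by (rule sum_atLeast1_eq_lessThan)
  moreover have "(\<lambda>n. \<Sum>k<Suc n. leading_term p k) \<longlonglongrightarrow> (\<Sum>k. leading_term p k)"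
    using summable_LIMSEQ[OF summable_leading_term[OF assms]] by (rule LIMSEQ_Suc)
  ultimately show ?thesis by (simp add: zeta_def limI)
qed

lemma binom_transform_tendsto:
  assumes "summable (\<lambda>k. \<bar>g k\<bar>)" "g 0 = 0"
  shows "binom_transform g \<longlonglongrightarrow> (\<Sum>k. g k)"
proof -
  have lim: "(\<lambda>n. binom_ratio n k * g k) \<longlonglongrightarrow> g k" for k
    using tendsto_mult[OF binom_ratio_tendsto_1[of k] tendsto_const[of "g k"]] by simp
  have "norm (binom_ratio n k * g k) \<le> \<bar>g k\<bar>" for n k
    using binom_ratio_nonneg[of n k] binom_ratio_le_1[of n k]
    by (simp add: abs_mult mult_left_le_one_le)
  then have dom: "\<forall>\<^sub>F (k, n) in sequentially \<times>\<^sub>F sequentially. norm (binom_ratio n k * g k) \<le> \<bar>g k\<bar>"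
    by (intro always_eventually) auto
  \<comment> \<open>Weights vanish beyond \<open>n\<close>, and \<open>g 0 = 0\<close> accounts for
    the index \<open>0\<close>, where the weight is \<open>1\<close>. The finite sum is therefore a
    series to which Tannery's theorem applies.\<close>
  have "binom_transform g n = (\<Sum>k. binom_ratio n k * g k)" for n
    unfolding binom_transform_def using assms(2)
    by (subst suminf_finite[of "{1..n}"]) (auto simp: binom_ratio_eq_0 not_le Suc_le_eq)
  then have "binom_transform g = (\<lambda>n. \<Sum>k. binom_ratio n k * g k)" ..
  then show ?thesis
    using tannerys_theorem[where a = "\<lambda>k n. binom_ratio n k * g k" and b = g, OF lim dom assms(1)]
    by (simp only: sequentially_bot simp_thms)
qed

theorem theorem1p2:
  fixes r :: nat and a :: "nat \<Rightarrow> nat"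
  assumes "r \<ge> 1" and "a 1 \<ge> 1" and "a (r + 1) \<ge> 1"
  shows "zeta_star (concat (map (\<lambda>j. replicate (a j) 2 @ [1]) [1..<r + 1]) @ replicate (a (r + 1)) 2)
       = - (\<Sum>p\<in>merges (map (\<lambda>j. 2 * int (a j) + 1) [1..<r + 1] @ [- (2 * int (a (r + 1)))]).
              2 ^ length p * zeta p)"
proof -
  define s where "s = map (\<lambda>j. 2 * int (a j) + 1) [1..<r + 1] @ [- (2 * int (a (r + 1)))]"
  define g where "g k = - merge_sum s k" for k
  have "[1..<r + 1] = 1 # [2..<r + 1]"
    using \<open>r \<ge> 1\<close> by (subst upt_conv_Cons) (auto simp: numeral_2_eq_2)
  then have "s = (2 * int (a 1) + 1) # map (\<lambda>j. 2 * int (a j) + 1) [2..<r + 1] @ [- (2 * int (a (r + 1)))]"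
    by (simp only: s_def list.map append_Cons)
  then have hd_s: "s \<noteq> []" "\<bar>hd s\<bar> \<ge> 3"
    using \<open>a 1 \<ge> 1\<close> by auto
  have "0 \<notin> set s"
    using \<open>a (r + 1) \<ge> 1\<close> by (auto simp: s_def)
  \<comment> \<open>Merging never lowers the absolute value of the first entry, so every
    \<open>p\<close> inherits the bound \<open>3\<close> from \<open>2 * a 1 + 1\<close>.\<close>
  then have p: "0 \<notin> set p" "p \<noteq> []" "\<bar>hd p\<bar> \<ge> 3" if "p \<in> merges s" for p
    using zero_notin_merges[OF that] merges_nonempty[OF that] merges_hd[OF that] hd_s by auto
  have bound: "\<bar>g k\<bar> \<le> (\<Sum>p\<in>merges s. 2 ^ length p) * inverse (real k ^ 2)" for k
    unfolding g_def merge_sum_def abs_minus_cancel sum_distrib_right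
    by (intro order_trans[OF sum_abs sum_mono])
      (simp only: abs_mult power_abs abs_numeral inverse_eq_divide, intro mult_left_mono abs_leading_term_le p, auto)
  have "summable (\<lambda>k. (\<Sum>p\<in>merges s. 2 ^ length p) * inverse (real k ^ 2))"
    by (intro summable_mult inverse_power_summable) simp
  then have "summable (\<lambda>k. \<bar>g k\<bar>)"
    by (rule summable_comparison_test'[where N = 0]) (use bound in auto)
  \<comment> \<open>Here \<open>inverse 0 = 0\<close> makes the bound at \<open>k = 0\<close> equal
    to \<open>0\<close>.\<close>
  moreover have "g 0 = 0" using bound[of 0] by simp
  ultimately have lim: "binom_transform g \<longlonglongrightarrow> (\<Sum>k. g k)"
    by (rule binom_transform_tendsto)
  have "H_star n (concat (map (\<lambda>j. replicate (a j) 2 @ [1]) [1..<r + 1]) @ replicate (a (r + 1)) 2)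
      = binom_transform g n" if "n \<ge> 1" for n
    using H_star_eq_binom_transform[OF \<open>a (r + 1) \<ge> 1\<close> that, of "map a [1..<r + 1]"]
    by (simp add: g_def[abs_def] s_def comp_def)
  then have "zeta_star (concat (map (\<lambda>j. replicate (a j) 2 @ [1]) [1..<r + 1]) @ replicate (a (r + 1)) 2)
      = (\<Sum>k. g k)"
    unfolding zeta_star_def using lim
    by (intro limI) (rule Lim_transform_eventually, assumption,
        auto intro!: eventually_sequentiallyI[of 1])
  also have "\<dots> = - (\<Sum>k. \<Sum>p\<in>merges s. 2 ^ length p * leading_term p k)"
    unfolding g_def merge_sum_def
    by (intro suminf_minus summable_sum summable_mult summable_leading_term p)
  also have "(\<Sum>k. \<Sum>p\<in>merges s. 2 ^ length p * leading_term p k)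
      = (\<Sum>p\<in>merges s. \<Sum>k. 2 ^ length p * leading_term p k)"
    by (intro suminf_sum summable_mult summable_leading_term p)
  also have "\<dots> = (\<Sum>p\<in>merges s. 2 ^ length p * zeta p)"
    by (intro sum.cong refl) (simp add: suminf_mult summable_leading_term p zeta_eq_suminf)
  finally show ?thesis by (simp add: s_def)
qed

end
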